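(* A BFS blockchain (not equipped with additional mechanisms) does not implement transaction monitors; that is, there is a monitored smart contract that cannot be written as an unmonitored smart contract in a BFS blockchain.
   Context: Blockchain model. A configuration is a pair $(\Sigma,\Delta)$: $\Sigma$ is a partial map from addresses to the storage ($st$) and balance of smart contracts, and $\Delta$ is a context with additional information (block number, time, etc.). An operation $o$ is a record with fields $dest$ (invoked address), $src$ (source address), $param$ (parameters) and $money$ (amount sent). A smart contract is a deterministic partial map $A:\Delta\times P\times S\times\mathbb{N}\rightharpoonup S\times[\mathcal{O}]$ taking context, parameters, current storage and balance to a new storage and a list of new operations; undefined means failure. A fixed partial map $\mathbb{G}$ assigns contracts to addresses. Executing $o$ from $(\Sigma,\Delta)$ succeeds iff the balance of $o.src$ is at least $o.money$ and $\mathbb{G}(o.dest)(\Delta,o.param,\Sigma(o.dest).st,\Sigma(o.dest).balance)=(st',ls)$ is defined; then $o.money$ is moved from $o.src$ to $o.dest$, the storage of $o.dest$ becomes $st'$, and the new operations $ls$ are emitted. A transaction starts with pending list $[o]$, $o$ an external operation, and repeatedly executes the head $o$ of the pending list $o::os$; in a BFS blockchain the new pending list is $os \mathbin{+\!\!+} ls$ (new operations are appended at the end). If an operation fails, the transaction fails and the state is unchanged; if the pending list becomes empty, the transaction commits. Contracts have no access to the pending list or to information about the current transaction (such as its beginning, its end, or earlier invocations in it) other than through their own storage. Gas: there is always sufficient gas for finite executions, and a transaction whose execution never ends fails by gas exhaustion. Transaction monitors. A monitored smart contract is a contract $A$ together with a private monitor storage and four functions $A_{init},A_{begin},A_{end},A_{term}$,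 which cannot emit operations or modify the contract storage, but can fail, in which case the whole transaction fails. $A_{init}$ runs before the first invocation of $A$ in a transaction; it reads the storage and balance of $A$ and reads and writes the monitor storage. $A_{begin}$ runs before each operation executed in $A$, with the operation's arguments and the monitor storage, which it may modify. $A_{end}$ runs after each operation executed in $A$, with the operation's result (emitted operations and new storage) and the monitor storage, which it may modify. $A_{term}$ runs at the end of the transaction (when the pending list is empty) for each contract $A$ visited in the transaction; it reads the storage and balance of $A$ and the monitor storage, without modifying the latter. If none of these functions fails, the effect on the blockchain is the same as without monitors. Implementation. A blockchain implements transaction monitors iff it can write every monitored smart contract; i.e. for each monitored contract there is an unmonitored contract (possibly with auxiliary storage fields and auxiliary private methods) that can replace it, with the same transactions failing or committing and the same behaviour of the contract. *)

theory Defs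
  imports Main "HOL-Library.Monad_Syntax"
begin

section \<open>Configurations, operations and contracts\<close>

text \<open>
  Block contexts and primitive values are arbitrary types \<open>'c\<close> and \<open>'v\<close>.  A storage maps field
  names to values and a parameter is a method name with an argument; names are needed to speak of
  auxiliary storage fields and auxiliary methods.
\<close>

type_synonym address = nat
type_synonym 'v storage = "string \<rightharpoonup> 'v"
type_synonym 'v parameter = "string \<times> 'v"

record 'v operation =
  dest :: address
  src :: address
  param :: "'v parameter"
  money :: nat

record 'v account =
  st :: "'v storage"
  balance :: nat

text \<open>External users own accounts as well, since operations are paid by their source.\<close>

type_synonym 'v state = "address \<rightharpoonup> 'v account"

type_synonym ('c, 'v) code =
  "'c \<Rightarrow> 'v parameter \<Rightarrow> 'v storage \<Rightarrow> nat \<Rightarrow> ('v storage \<times> 'v operation list) option"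

text \<open>Private methods can be invoked only by operations whose source is the contract itself.\<close>

record ('c, 'v) contract =
  body :: "('c, 'v) code"
  private_methods :: "string set"

type_synonym ('c, 'v) contracts = "address \<rightharpoonup> ('c, 'v) contract"

definition honest :: "address \<Rightarrow> ('c, 'v) contract \<Rightarrow> bool" where
  "honest a C \<longleftrightarrow>
     (\<forall>\<Delta> p s n s' ls. body C \<Delta> p s n = Some (s', ls) \<longrightarrow> (\<forall>op \<in> set ls. src op = a))"

section \<open>Transactions in a BFS blockchain\<close>

definition update_account :: "address \<Rightarrow> ('v account \<Rightarrow> 'v account) \<Rightarrow> 'v state \<Rightarrow> 'v state" where
  "update_account a f \<Sigma> = \<Sigma>(a := map_option f (\<Sigma> a))"

definition apply_operation :: "'v operation \<Rightarrow> 'v storage \<Rightarrow> 'v state \<Rightarrow> 'v state" where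
  "apply_operation op s' \<Sigma> =
     update_account (dest op) (\<lambda>acc. acc\<lparr>st := s', balance := balance acc + money op\<rparr>)
       (update_account (src op) (\<lambda>acc. acc\<lparr>balance := balance acc - money op\<rparr>) \<Sigma>)"

definition exec_op ::
  "('c, 'v) contracts \<Rightarrow> 'c \<Rightarrow> 'v state \<Rightarrow> 'v operation \<Rightarrow> ('v state \<times> 'v operation list) option" where
  "exec_op G \<Delta> \<Sigma> op = do {
     payer \<leftarrow> \<Sigma> (src op);
     target \<leftarrow> \<Sigma> (dest op);
     C \<leftarrow> G (dest op);
     if money op \<le> balance payer \<and> (fst (param op) \<in> private_methods C \<longrightarrow> src op = dest op)
     then do {
       (s', ls) \<leftarrow> body C \<Delta> (param op) (st target) (balance target);
       Some (apply_operation op s' \<Sigma>, ls)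
     }
     else None
   }"

inductive commits ::
  "('c, 'v) contracts \<Rightarrow> 'c \<Rightarrow> 'v state \<Rightarrow> 'v operation list \<Rightarrow> 'v state \<Rightarrow> bool"
  for G \<Delta> where
  commits_Nil: "commits G \<Delta> \<Sigma> [] \<Sigma>"
| commits_Cons: "\<lbrakk>exec_op G \<Delta> \<Sigma> op = Some (\<Sigma>', ls); commits G \<Delta> \<Sigma>' (ops @ ls) \<Sigma>''\<rbrakk>
    \<Longrightarrow> commits G \<Delta> \<Sigma> (op # ops) \<Sigma>''"

text \<open>
  \<open>None\<close> stands for a failed transaction.  An execution that never ends has no \<open>commits\<close>
  derivation, so it fails too (gas exhaustion).
\<close>

definition transaction ::
  "('c, 'v) contracts \<Rightarrow> 'c \<times> 'v operation \<Rightarrow> 'v state \<Rightarrow> 'v state option" where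
  "transaction G = (\<lambda>(\<Delta>, op) \<Sigma>.
     if \<exists>\<Sigma>'. commits G \<Delta> \<Sigma> [op] \<Sigma>' then Some (THE \<Sigma>'. commits G \<Delta> \<Sigma> [op] \<Sigma>') else None)"

section \<open>Transaction monitors\<close>

text \<open>
  In each function the last argument is the monitor storage.  \<open>None\<close>, or \<open>False\<close> for \<open>m_term\<close>, is
  a failure of the monitor.  The arguments of \<open>m_begin\<close> are those the contract is applied to;
  \<open>m_end\<close> gets the emitted operations and the new storage; \<open>m_init\<close> and \<open>m_term\<close> get the storage
  and the balance.
\<close>

record ('c, 'v) monitor =
  m_storage0 :: "'v storage"
  m_init :: "'v storage \<Rightarrow> nat \<Rightarrow> 'v storage \<Rightarrow> 'v storage option"
  m_begin :: "'c \<Rightarrow> 'v parameter \<Rightarrow> 'v storage \<Rightarrow> nat \<Rightarrow> 'v storage \<Rightarrow> 'v storage option"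
  m_end :: "'v operation list \<Rightarrow> 'v storage \<Rightarrow> 'v storage \<Rightarrow> 'v storage option"
  m_term :: "'v storage \<Rightarrow> nat \<Rightarrow> 'v storage \<Rightarrow> bool"

record ('c, 'v) monitored =
  contract_of :: "('c, 'v) contract"
  storage_fields :: "string set"
  monitor_of :: "('c, 'v) monitor"

text \<open>
  Finiteness of the fields and of the methods leaves names for the auxiliary fields and methods of
  a replacement.
\<close>

definition monitored_contract :: "address \<Rightarrow> ('c, 'v) monitored \<Rightarrow> bool" where
  "monitored_contract a M \<longleftrightarrow>
     honest a (contract_of M) \<and>
     finite (storage_fields M) \<and>
     finite {f. \<exists>\<Delta> v s n. body (contract_of M) \<Delta> (f, v) s n \<noteq> None} \<and>
     (\<forall>\<Delta> p s n s' ls. body (contract_of M) \<Delta> p s n = Some (s', ls) \<longrightarrow>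
        dom s \<subseteq> storage_fields M \<longrightarrow> dom s' \<subseteq> storage_fields M)"

type_synonym ('c, 'v) monitors = "address \<rightharpoonup> ('c, 'v) monitor"
type_synonym 'v monitor_state = "address \<Rightarrow> 'v storage"

text \<open>Besides the monitor storages, execution tracks the set of addresses visited so far.\<close>

type_synonym 'v run_state = "'v state \<times> 'v monitor_state \<times> address set"

definition monitored_exec_op ::
  "('c, 'v) contracts \<Rightarrow> ('c, 'v) monitors \<Rightarrow> 'c \<Rightarrow> 'v run_state \<Rightarrow> 'v operation
     \<Rightarrow> ('v run_state \<times> 'v operation list) option" where
  "monitored_exec_op G W \<Delta> = (\<lambda>(\<Sigma>, \<mu>, V) op.
     let a = dest op in
     case W a of
       None \<Rightarrow> do {
         (\<Sigma>', ls) \<leftarrow> exec_op G \<Delta> \<Sigma> op;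
         Some ((\<Sigma>', \<mu>, insert a V), ls)
       }
     | Some m \<Rightarrow> do {
         acc \<leftarrow> \<Sigma> a;
         m0 \<leftarrow> if a \<in> V then Some (\<mu> a) else m_init m (st acc) (balance acc) (\<mu> a);
         m1 \<leftarrow> m_begin m \<Delta> (param op) (st acc) (balance acc) m0;
         (\<Sigma>', ls) \<leftarrow> exec_op G \<Delta> \<Sigma> op;
         acc' \<leftarrow> \<Sigma>' a;
         m2 \<leftarrow> m_end m ls (st acc') m1;
         Some ((\<Sigma>', \<mu>(a := m2), insert a V), ls)
       })"

definition term_ok :: "('c, 'v) monitors \<Rightarrow> 'v run_state \<Rightarrow> bool" where
  "term_ok W = (\<lambda>(\<Sigma>, \<mu>, V).
     \<forall>a \<in> V. \<forall>m acc. W a = Some m \<longrightarrow> \<Sigma> a = Some acc \<longrightarrow>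
       m_term m (st acc) (balance acc) (\<mu> a))"

inductive monitored_commits ::
  "('c, 'v) contracts \<Rightarrow> ('c, 'v) monitors \<Rightarrow> 'c \<Rightarrow> 'v run_state \<Rightarrow> 'v operation list
     \<Rightarrow> 'v run_state \<Rightarrow> bool"
  for G W \<Delta> where
  monitored_commits_Nil: "term_ok W r \<Longrightarrow> monitored_commits G W \<Delta> r [] r"
| monitored_commits_Cons:
    "\<lbrakk>monitored_exec_op G W \<Delta> r op = Some (r', ls); monitored_commits G W \<Delta> r' (ops @ ls) r''\<rbrakk>
    \<Longrightarrow> monitored_commits G W \<Delta> r (op # ops) r''"

definition monitored_transaction ::
  "('c, 'v) contracts \<Rightarrow> ('c, 'v) monitors \<Rightarrow> 'c \<times> 'v operation
     \<Rightarrow> 'v state \<times> 'v monitor_state \<Rightarrow> ('v state \<times> 'v monitor_state) option" where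
  "monitored_transaction G W = (\<lambda>(\<Delta>, op) (\<Sigma>, \<mu>).
     if \<exists>r. monitored_commits G W \<Delta> (\<Sigma>, \<mu>, {}) [op] r
     then (case (THE r. monitored_commits G W \<Delta> (\<Sigma>, \<mu>, {}) [op] r) of
             (\<Sigma>', \<mu>', V) \<Rightarrow> Some (\<Sigma>', \<mu>'))
     else None)"

section \<open>Implementing a monitored contract\<close>

text \<open>The outcomes of a sequence of transactions; a failed one leaves the state unchanged.\<close>

fun outcomes :: "('t \<Rightarrow> 's \<Rightarrow> 's option) \<Rightarrow> 't list \<Rightarrow> 's \<Rightarrow> 's option list" where
  "outcomes f [] s = []"
| "outcomes f (t # ts) s = f t s # outcomes f ts (case f t s of None \<Rightarrow> s | Some s' \<Rightarrow> s')"

text \<open>Equality of states up to the auxiliary storage fields at address \<open>a\<close> in the second one.\<close>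

definition same_up_to_aux :: "address \<Rightarrow> string set \<Rightarrow> 'v state \<Rightarrow> 'v state \<Rightarrow> bool" where
  "same_up_to_aux a F \<Sigma> \<Sigma>' \<longleftrightarrow>
     \<Sigma> = update_account a (\<lambda>acc. acc\<lparr>st := st acc |` F\<rparr>) \<Sigma>'"

text \<open>
  \<open>C\<close> replaces \<open>M\<close> at address \<open>a\<close> among the contracts \<open>G\<close>: from every initial state, for a suitable
  choice of the auxiliary fields, every sequence of external transactions has the same outcomes.
  Only the states between transactions are compared, so \<open>C\<close> may emit additional operations.
  Consecutive transactions may have the same context, as in a common block.
\<close>

definition replaces ::
  "('c, 'v) contracts \<Rightarrow> address \<Rightarrow> ('c, 'v) monitored \<Rightarrow> ('c, 'v) contract \<Rightarrow> bool" where
  "replaces G a M C \<longleftrightarrow>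
     (\<forall>\<Sigma> acc. dom G \<subseteq> dom \<Sigma> \<and> \<Sigma> a = Some acc \<and> dom (st acc) \<subseteq> storage_fields M \<longrightarrow>
       (\<exists>s. s |` storage_fields M = st acc \<and>
         (\<forall>ts. (\<forall>(\<Delta>, op) \<in> set ts. src op \<notin> insert a (dom G)) \<longrightarrow>
           list_all2 (rel_option (\<lambda>(\<Sigma>m, \<mu>) \<Sigma>p. same_up_to_aux a (storage_fields M) \<Sigma>m \<Sigma>p))
             (outcomes (monitored_transaction (G(a \<mapsto> contract_of M)) [a \<mapsto> monitor_of M]) ts
                (\<Sigma>, (\<lambda>_. Map.empty)(a := m_storage0 (monitor_of M))))
             (outcomes (transaction (G(a \<mapsto> C))) ts (\<Sigma>(a \<mapsto> acc\<lparr>st := s\<rparr>))))))"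

definition environment :: "address \<Rightarrow> ('c, 'v) contracts \<Rightarrow> bool" where
  "environment a G \<longleftrightarrow> a \<notin> dom G \<and> (\<forall>b C. G b = Some C \<longrightarrow> honest b C)"

text \<open>
  The replacement may depend on the other contracts and need not be honest.  Both choices make
  implementing easier.
\<close>

definition writable_in_BFS :: "address \<Rightarrow> ('c, 'v) monitored \<Rightarrow> bool" where
  "writable_in_BFS a M \<longleftrightarrow> (\<forall>G. environment a G \<longrightarrow> (\<exists>C. replaces G a M C))"

end

theory Submission
  imports Defs
begin

text \<open>
  The monitor lets its contract be invoked at most once per transaction.  An unmonitored
  replacement accepts an invocation in each of two consecutive transactions, and the first of them
  ends after finitely many steps.  Another contract can invoke the replacement, keep the queue busy
  with calls to itself until everything caused by that invocation has been executed, and then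
  invoke it again.  In a BFS queue the idle calls do not affect the order of the other operations,
  so the replacement runs exactly as in the two separate transactions, and accepts; the monitor
  rejects.
\<close>

section \<open>BFS execution\<close>

lemma update_account_id:
  assumes "\<And>acc. \<Sigma> a = Some acc \<Longrightarrow> f acc = acc"
  shows "update_account a f \<Sigma> = \<Sigma>"
  using assms by (cases "\<Sigma> a") (auto simp: update_account_def fun_upd_idem)

lemma dom_update_account [simp]: "dom (update_account a f \<Sigma>) = dom \<Sigma>"
  by (auto simp: update_account_def split: if_splits)

lemma dom_apply_operation [simp]: "dom (apply_operation op s \<Sigma>) = dom \<Sigma>"
  by (simp add: apply_operation_def)

lemma apply_operation_money_0:
  assumes "money op = 0"
  shows "apply_operation op s \<Sigma> = update_account (dest op) (\<lambda>acc. acc\<lparr>st := s\<rparr>) \<Sigma>"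
  using assms by (simp add: apply_operation_def update_account_id)

lemma apply_operation_id:
  assumes "money op = 0" "\<Sigma> (dest op) = Some acc"
  shows "apply_operation op (st acc) \<Sigma> = \<Sigma>"
  unfolding apply_operation_money_0[OF assms(1)]
  by (rule update_account_id) (use assms(2) in \<open>cases acc, auto\<close>)

lemma exec_op_dom:
  assumes "exec_op G \<Delta> \<Sigma> op = Some (\<Sigma>', ls)"
  shows "dom \<Sigma>' = dom \<Sigma>"
proof -
  from assms obtain s where "\<Sigma>' = apply_operation op s \<Sigma>"
    by (auto simp: exec_op_def split: Option.bind_splits if_splits)
  then show ?thesis
    by simp
qed

lemma commits_Nil_iff [simp]: "commits G \<Delta> \<Sigma> [] \<Sigma>' \<longleftrightarrow> \<Sigma>' = \<Sigma>"
  by (auto elim: commits.cases intro: commits.intros)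

lemma commits_Cons_iff:
  "commits G \<Delta> \<Sigma> (op # ops) \<Sigma>'' \<longleftrightarrow>
     (\<exists>\<Sigma>' ls. exec_op G \<Delta> \<Sigma> op = Some (\<Sigma>', ls) \<and> commits G \<Delta> \<Sigma>' (ops @ ls) \<Sigma>'')"
  by (auto elim: commits.cases intro: commits.intros)

lemma commits_deterministic:
  assumes "commits G \<Delta> \<Sigma> ops \<Sigma>'" "commits G \<Delta> \<Sigma> ops \<Sigma>''"
  shows "\<Sigma>' = \<Sigma>''"
  using assms
proof (induction arbitrary: \<Sigma>'' rule: commits.induct)
  case (commits_Nil \<Sigma>)
  then show ?case
    by simp
next
  case (commits_Cons \<Sigma> op \<Sigma>' ls ops \<Sigma>1)
  from commits_Cons.prems commits_Cons.hyps(1) have "commits G \<Delta> \<Sigma>' (ops @ ls) \<Sigma>''"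
    by (simp add: commits_Cons_iff)
  then show ?case
    by (rule commits_Cons.IH)
qed

lemma transaction_eq_Some_iff:
  "transaction G (\<Delta>, op) \<Sigma> = Some \<Sigma>' \<longleftrightarrow> commits G \<Delta> \<Sigma> [op] \<Sigma>'"
proof -
  have "(THE \<Sigma>'. commits G \<Delta> \<Sigma> [op] \<Sigma>') = \<Sigma>'" if "commits G \<Delta> \<Sigma> [op] \<Sigma>'" for \<Sigma>'
    using that by (blast intro: commits_deterministic)
  then show ?thesis
    by (auto simp: transaction_def)
qed

lemma commits_dom:
  assumes "commits G \<Delta> \<Sigma> ops \<Sigma>'"
  shows "dom \<Sigma>' = dom \<Sigma>"
  using assms by induction (simp_all add: exec_op_dom)

section \<open>The relay contract\<close>

text \<open>With no money sent, any existing account can pay and no balance changes. The argument is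
  the arbitrary value \<open>undefined\<close>, since \<open>'v\<close> has no distinguished
  element.\<close>

definition call :: "address \<Rightarrow> address \<Rightarrow> string \<Rightarrow> 'v operation" where
  "call x y f = \<lparr>dest = y, src = x, param = (f, undefined), money = 0\<rparr>"

lemma call_simps [simp]:
  "dest (call x y f) = y" "src (call x y f) = x" "param (call x y f) = (f, undefined)"
  "money (call x y f) = 0"
  by (simp_all add: call_def)

text \<open>
  The method name is a program: the letter p invokes \<open>a\<close>, every other letter is an idle step, and
  the end of the program invokes \<open>a\<close> a last time.  Method names serve as counters because the
  type of values may have a single element.
\<close>

definition relay :: "address \<Rightarrow> address \<Rightarrow> ('c, 'v) contract" where
  "relay a b =
     \<lparr>body = (\<lambda>\<Delta> p s n. Some (s,
        case fst p of
          [] \<Rightarrow> [call b a []]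
        | c # f \<Rightarrow> (if c = CHR ''p'' then [call b a []] else []) @ [call b b f])),
      private_methods = {}\<rparr>"

lemma honest_relay: "honest b (relay a b)"
  by (auto simp: honest_def relay_def split: list.splits if_splits)

lemma exec_op_relay:
  assumes "G b = Some (relay a b)" "b \<in> dom \<Sigma>" "x \<in> dom \<Sigma>"
  shows "exec_op G \<Delta> \<Sigma> (call x b f) = Some (\<Sigma>,
    case f of
      [] \<Rightarrow> [call b a []]
    | c # f \<Rightarrow> (if c = CHR ''p'' then [call b a []] else []) @ [call b b f])"
  using assms by (auto simp: exec_op_def relay_def apply_operation_id)

text \<open>An idle step leaves the state unchanged and moves the relay's call to the end of the
  queue, so all other operations keep their order. \<open>k\<close> counts how often the call
  reaches the head before nothing else is pending; it does not depend on \<open>f\<close>, the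
  program left at that moment. The induction ranges over all splits \<open>X @ Y\<close>, because
  the call changes its position in the queue.\<close>

lemma commits_interleave_idle:
  assumes "commits G \<Delta> \<Sigma> (X @ Y) \<Sigma>1" "G b = Some (relay a b)" "b \<in> dom \<Sigma>"
  shows "\<exists>k. \<forall>f \<Sigma>2. commits G \<Delta> \<Sigma>1 [call b b f] \<Sigma>2 \<longrightarrow>
    commits G \<Delta> \<Sigma> (X @ call b b (replicate k CHR ''w'' @ f) # Y) \<Sigma>2"
  using assms(1,3)
proof (induction \<Sigma> "X @ Y" \<Sigma>1 arbitrary: X Y rule: commits.induct)
  case (commits_Nil \<Sigma>)
  then show ?case
    by (intro exI[of _ 0]) simp
next
  case (commits_Cons \<Sigma> op \<Sigma>' ls ops \<Sigma>1)
  \<comment> \<open>Another operation is at the head: its emissions join the end of the queue, and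
    the idle call spends no letter.\<close>
  have *: "\<exists>k. \<forall>f \<Sigma>2. commits G \<Delta> \<Sigma>1 [call b b f] \<Sigma>2 \<longrightarrow>
      commits G \<Delta> \<Sigma> (op # X' @ call b b (replicate k CHR ''w'' @ f) # Y') \<Sigma>2"
    if "ops = X' @ Y'" for X' Y'
  proof -
    have "b \<in> dom \<Sigma>'"
      using commits_Cons.hyps(1) commits_Cons.prems exec_op_dom by metis
    with commits_Cons.hyps(3)[of X' "Y' @ ls"] that
    obtain k where "\<And>f \<Sigma>2. commits G \<Delta> \<Sigma>1 [call b b f] \<Sigma>2 \<Longrightarrow>
        commits G \<Delta> \<Sigma>' (X' @ call b b (replicate k CHR ''w'' @ f) # Y' @ ls) \<Sigma>2"
      by auto
    with commits_Cons.hyps(1) show ?thesis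
      by (intro exI[of _ k]) (simp add: commits_Cons_iff)
  qed
  show ?case
  proof (cases X)
    case Nil
    with commits_Cons.hyps(4) have Y: "Y = op # ops"
      by simp
    \<comment> \<open>The idle call is at the head. One idle step puts it behind all of
      \<open>Y\<close>, where the claim above applies with nothing after the call;
      \<open>Suc k\<close> accounts for this step.\<close>
    from *[of ops "[]"] obtain k where k: "\<And>f \<Sigma>2. commits G \<Delta> \<Sigma>1 [call b b f] \<Sigma>2 \<Longrightarrow>
        commits G \<Delta> \<Sigma> (Y @ [call b b (replicate k CHR ''w'' @ f)]) \<Sigma>2"
      by (auto simp: Y)
    show ?thesis
    proof (intro exI[of _ "Suc k"] allI impI)
      fix f \<Sigma>2
      assume "commits G \<Delta> \<Sigma>1 [call b b f] \<Sigma>2"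
      from k[OF this] show "commits G \<Delta> \<Sigma> (X @ call b b (replicate (Suc k) CHR ''w'' @ f) # Y) \<Sigma>2"
        using exec_op_relay[of G b a, OF assms(2) commits_Cons.prems commits_Cons.prems] Nil
        by (simp add: commits_Cons_iff[of _ _ _ "call b b _"])
    qed
  next
    case (Cons x X')
    with commits_Cons.hyps(4) *[of X' Y] show ?thesis
      by auto
  qed
qed

text \<open>The code of a contract does not see the source. Success with \<open>x \<noteq> y\<close>
  shows that \<open>f\<close> is not private at \<open>y\<close>, and a payment of 0 only needs the
  payer to exist. The relay can therefore take the place of an external user.\<close>

lemma exec_op_call_src:
  assumes "exec_op G \<Delta> \<Sigma> (call x y f) = Some r" "x \<noteq> y" "z \<in> dom \<Sigma>"
  shows "exec_op G \<Delta> \<Sigma> (call z y f) = Some r"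
  using assms by (auto simp: exec_op_def apply_operation_money_0 split: Option.bind_splits if_splits)

lemma commits_call_src:
  assumes "commits G \<Delta> \<Sigma> [call x y f] \<Sigma>'" "x \<noteq> y" "z \<in> dom \<Sigma>"
  shows "commits G \<Delta> \<Sigma> [call z y f] \<Sigma>'"
proof -
  from assms(1) obtain \<Sigma>1 ls
    where "exec_op G \<Delta> \<Sigma> (call x y f) = Some (\<Sigma>1, ls)" "commits G \<Delta> \<Sigma>1 ls \<Sigma>'"
    by (auto simp: commits_Cons_iff)
  then show ?thesis
    using exec_op_call_src[OF _ assms(2,3)] by (fastforce simp: commits_Cons_iff[of _ _ _ "call _ _ _"])
qed

text \<open>The program invokes \<open>a\<close>, waits exactly until the effects of this invocation
  are exhausted, which happens in state \<open>\<Sigma>1\<close>, and invokes \<open>a\<close>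
  again. Both given executions must share the context \<open>\<Delta>\<close>, as they become one
  transaction.\<close>

lemma commits_relay_two_calls:
  assumes "commits G \<Delta> \<Sigma> [call u a []] \<Sigma>1" "commits G \<Delta> \<Sigma>1 [call u a []] \<Sigma>2"
    and "G b = Some (relay a b)" "b \<in> dom \<Sigma>" "u \<in> dom \<Sigma>" "u \<noteq> a"
  shows "\<exists>f. commits G \<Delta> \<Sigma> [call u b (CHR ''p'' # f)] \<Sigma>2"
proof -
  have b1: "b \<in> dom \<Sigma>1"
    using assms(1,4) commits_dom by metis
  \<comment> \<open>The empty program is what remains after the waiting letters; it starts the
    second execution with source \<open>b\<close>.\<close>
  have "commits G \<Delta> \<Sigma>1 [call b b []] \<Sigma>2"
    using exec_op_relay[of G b a \<Sigma>1 b \<Delta> "[]"] commits_call_src[OF assms(2,6) b1] assms(3) b1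
    by (simp add: commits_Cons_iff[of _ _ _ "call b b _"])
  moreover have "commits G \<Delta> \<Sigma> ([call b a []] @ []) \<Sigma>1"
    using commits_call_src[OF assms(1,6,4)] by simp
  ultimately obtain f where "commits G \<Delta> \<Sigma> [call b a [], call b b f] \<Sigma>2"
    using commits_interleave_idle[of G \<Delta> \<Sigma> "[call b a []]" "[]" \<Sigma>1 b a] assms(3,4) by fastforce
  then have "commits G \<Delta> \<Sigma> [call u b (CHR ''p'' # f)] \<Sigma>2"
    using exec_op_relay[of G b a, OF assms(3-5), of \<Delta> "CHR ''p'' # f"]
    by (simp add: commits_Cons_iff[of _ _ _ "call u b _"])
  then show ?thesis ..
qed

section \<open>The monitor\<close>

lemma monitored_commits_Nil_iff [simp]:
  "monitored_commits G W \<Delta> r [] r' \<longleftrightarrow> r' = r \<and> term_ok W r"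
  by (auto elim: monitored_commits.cases intro: monitored_commits.intros)

lemma monitored_commits_Cons_iff:
  "monitored_commits G W \<Delta> r (op # ops) r'' \<longleftrightarrow>
     (\<exists>r' ls. monitored_exec_op G W \<Delta> r op = Some (r', ls) \<and>
        monitored_commits G W \<Delta> r' (ops @ ls) r'')"
proof
  assume "monitored_commits G W \<Delta> r (op # ops) r''"
  then show "\<exists>r' ls. monitored_exec_op G W \<Delta> r op = Some (r', ls) \<and>
      monitored_commits G W \<Delta> r' (ops @ ls) r''"
    by cases auto
qed (blast intro: monitored_commits.intros)

lemma monitored_commits_deterministic:
  assumes "monitored_commits G W \<Delta> r ops r'" "monitored_commits G W \<Delta> r ops r''"
  shows "r' = r''"
  using assms
proof (induction arbitrary: r'' rule: monitored_commits.induct)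
  case (monitored_commits_Nil r)
  then show ?case
    by simp
next
  case (monitored_commits_Cons r op r' ls ops r1)
  from monitored_commits_Cons.prems monitored_commits_Cons.hyps(1)
  have "monitored_commits G W \<Delta> r' (ops @ ls) r''"
    by (simp add: monitored_commits_Cons_iff)
  then show ?case
    by (rule monitored_commits_Cons.IH)
qed

lemma monitored_transactionI:
  assumes "monitored_commits G W \<Delta> (\<Sigma>, \<mu>, {}) [op] (\<Sigma>', \<mu>', V)"
  shows "monitored_transaction G W (\<Delta>, op) (\<Sigma>, \<mu>) = Some (\<Sigma>', \<mu>')"
proof -
  have "(THE r. monitored_commits G W \<Delta> (\<Sigma>, \<mu>, {}) [op] r) = (\<Sigma>', \<mu>', V)"
    using assms by (blast intro: monitored_commits_deterministic)
  with assms show ?thesis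
    by (auto simp: monitored_transaction_def)
qed

text \<open>The flag is the presence of the field \<open>[]\<close>, not its value, since
  \<open>'v\<close> may have a single element. \<open>m_init\<close> clears it in every
  transaction.\<close>

definition once_monitor :: "('c, 'v) monitor" where
  "once_monitor =
     \<lparr>m_storage0 = Map.empty,
      m_init = (\<lambda>s n \<mu>. Some Map.empty),
      m_begin = (\<lambda>\<Delta> p s n \<mu>. if \<mu> = Map.empty then Some [[] \<mapsto> undefined] else None),
      m_end = (\<lambda>ls s \<mu>. Some \<mu>),
      m_term = (\<lambda>s n \<mu>. True)\<rparr>"

text \<open>Accepting only the method \<open>[]\<close> meets the finiteness condition of
  \<open>monitored_contract\<close>.\<close>

definition once :: "('c, 'v) monitored" where
  "once =
     \<lparr>contract_of =
        \<lparr>body = (\<lambda>\<Delta> p s n. if fst p = [] then Some (s, []) else None), private_methods = {}\<rparr>,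
      storage_fields = {},
      monitor_of = once_monitor\<rparr>"

lemma monitored_contract_once: "monitored_contract a once"
proof -
  have "{f. \<exists>\<Delta> v s n. body (contract_of once) \<Delta> (f, v) s n \<noteq> None} = {[]}"
    by (auto simp: once_def)
  then show ?thesis
    by (auto simp: monitored_contract_def honest_def once_def split: if_splits)
qed

text \<open>\<open>\<mu>\<close> is arbitrary because \<open>m_init\<close> discards it: a flag left
  by one transaction does not block the next.\<close>

lemma monitored_transaction_once:
  assumes "G a = Some (contract_of once)" "a \<in> dom \<Sigma>" "u \<in> dom \<Sigma>"
  shows "\<exists>\<mu>'. monitored_transaction G [a \<mapsto> once_monitor] (\<Delta>, call u a []) (\<Sigma>, \<mu>) = Some (\<Sigma>, \<mu>')"
proof -
  have "exec_op G \<Delta> \<Sigma> (call u a []) = Some (\<Sigma>, [])"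
    using assms by (auto simp: exec_op_def once_def apply_operation_id)
  then have "monitored_exec_op G [a \<mapsto> once_monitor] \<Delta> (\<Sigma>, \<mu>, {}) (call u a []) =
      Some ((\<Sigma>, \<mu>(a := [[] \<mapsto> undefined]), {a}), [])"
    using assms by (auto simp: monitored_exec_op_def once_monitor_def)
  then have "monitored_commits G [a \<mapsto> once_monitor] \<Delta> (\<Sigma>, \<mu>, {}) [call u a []]
      (\<Sigma>, \<mu>(a := [[] \<mapsto> undefined]), {a})"
    by (auto simp: monitored_commits_Cons_iff term_ok_def once_monitor_def)
  then show ?thesis
    by (blast intro: monitored_transactionI)
qed

text \<open>As \<open>a\<close> is already visited, \<open>m_init\<close> is skipped and
  \<open>m_begin\<close> meets the flag.\<close>

lemma once_second_call_fails:
  assumes "a \<in> V" "\<mu> a \<noteq> Map.empty" "dest op = a"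
  shows "\<not> monitored_commits G [a \<mapsto> once_monitor] \<Delta> (\<Sigma>, \<mu>, V) (op # ops) r"
  using assms
  by (auto simp: monitored_commits_Cons_iff monitored_exec_op_def once_monitor_def
      split: Option.bind_splits)

section \<open>The monitored contract invoked by the relay\<close>

lemma monitored_exec_op_relay:
  assumes "G b = Some (relay a b)" "a \<noteq> b"
    and "monitored_exec_op G [a \<mapsto> m] \<Delta> (\<Sigma>, \<mu>, V) (call x b f) = Some (r, ls)"
  shows "r = (\<Sigma>, \<mu>, insert b V) \<and> ls = (case f of
      [] \<Rightarrow> [call b a []]
    | c # f \<Rightarrow> (if c = CHR ''p'' then [call b a []] else []) @ [call b b f])"
proof -
  from assms have "b \<in> dom \<Sigma>" "x \<in> dom \<Sigma>"
    by (auto simp: monitored_exec_op_def exec_op_def split: Option.bind_splits)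
  from assms(2,3) exec_op_relay[of G b a, OF assms(1) this, of \<Delta> f] show ?thesis
    by (auto simp: monitored_exec_op_def)
qed

text \<open>Every program invokes \<open>a\<close>, at the latest when it ends, and the relay's own
  steps leave the flag in place. \<open>V\<close> is generalised because each step inserts
  \<open>b\<close>.\<close>

lemma once_relay_fails:
  assumes "G b = Some (relay a b)" "a \<noteq> b" "a \<in> V" "\<mu> a \<noteq> Map.empty"
  shows "\<not> monitored_commits G [a \<mapsto> once_monitor] \<Delta> (\<Sigma>, \<mu>, V) [call b b f] r"
  using assms(3)
proof (induction f arbitrary: V)
  case Nil
  show ?case
  proof
    assume "monitored_commits G [a \<mapsto> once_monitor] \<Delta> (\<Sigma>, \<mu>, V) [call b b []] r"
    with monitored_exec_op_relay[of G b a, OF assms(1,2)]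
    have "monitored_commits G [a \<mapsto> once_monitor] \<Delta> (\<Sigma>, \<mu>, insert b V) [call b a []] r"
      by (fastforce simp: monitored_commits_Cons_iff[of _ _ _ _ "call b b _"])
    with Nil assms(4) show False
      by (simp add: once_second_call_fails)
  qed
next
  case (Cons c f)
  show ?case
  proof
    assume "monitored_commits G [a \<mapsto> once_monitor] \<Delta> (\<Sigma>, \<mu>, V) [call b b (c # f)] r"
    with monitored_exec_op_relay[of G b a, OF assms(1,2)]
    have "monitored_commits G [a \<mapsto> once_monitor] \<Delta> (\<Sigma>, \<mu>, insert b V)
        ((if c = CHR ''p'' then [call b a []] else []) @ [call b b f]) r"
      by (fastforce simp: monitored_commits_Cons_iff[of _ _ _ _ "call b b (_ # _)"])
    moreover have "\<not> monitored_commits G [a \<mapsto> once_monitor] \<Delta> (\<Sigma>, \<mu>, insert b V) [call b b f] r"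
      using Cons.prems by (intro Cons.IH) simp
    moreover have "\<not> monitored_commits G [a \<mapsto> once_monitor] \<Delta> (\<Sigma>, \<mu>, insert b V)
        [call b a [], call b b f] r"
      using Cons.prems assms(4) by (intro once_second_call_fails) simp_all
    ultimately show False
      by (cases "c = CHR ''p''") simp_all
  qed
qed

text \<open>This holds for every \<open>f\<close>, as needed for a waiting time that depends on the
  replacement. The first invocation of \<open>a\<close> sets the flag and emits nothing, so the
  relay's next call is alone in the queue.\<close>

lemma once_relay_two_calls_fail:
  assumes "G b = Some (relay a b)" "G a = Some (contract_of once)" "a \<noteq> b"
  shows "monitored_transaction G [a \<mapsto> once_monitor] (\<Delta>, call u b (CHR ''p'' # f)) (\<Sigma>, \<mu>) = None"
proof -
  have False
    if "monitored_commits G [a \<mapsto> once_monitor] \<Delta> (\<Sigma>, \<mu>, {}) [call u b (CHR ''p'' # f)] r" for r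
  proof -
    from that obtain r1 ls
      where "monitored_exec_op G [a \<mapsto> once_monitor] \<Delta> (\<Sigma>, \<mu>, {}) (call u b (CHR ''p'' # f)) = Some (r1, ls)"
        and "monitored_commits G [a \<mapsto> once_monitor] \<Delta> r1 ls r"
      by (auto simp: monitored_commits_Cons_iff)
    with monitored_exec_op_relay[of G b a, OF assms(1,3)]
    have "monitored_commits G [a \<mapsto> once_monitor] \<Delta> (\<Sigma>, \<mu>, {b}) [call b a [], call b b f] r"
      by fastforce
    then obtain r2 ls
      where step: "monitored_exec_op G [a \<mapsto> once_monitor] \<Delta> (\<Sigma>, \<mu>, {b}) (call b a []) = Some (r2, ls)"
        and rest: "monitored_commits G [a \<mapsto> once_monitor] \<Delta> r2 (call b b f # ls) r"
      by (auto simp: monitored_commits_Cons_iff)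
    from step assms obtain \<Sigma>' where "r2 = (\<Sigma>', \<mu>(a := [[] \<mapsto> undefined]), {a, b})" "ls = []"
      by (auto simp: monitored_exec_op_def exec_op_def once_def once_monitor_def
          split: Option.bind_splits if_splits)
    with rest once_relay_fails[of G b a, OF assms(1,3)] show False
      by auto
  qed
  then show ?thesis
    by (auto simp: monitored_transaction_def)
qed

section \<open>Refutation of an arbitrary replacement\<close>

lemma once_not_writable: "\<not> writable_in_BFS a (once :: ('c, 'v) monitored)"
proof
  define b where "b = Suc a"
  define u where "u = Suc b"
  define G :: "('c, 'v) contracts" where "G = [b \<mapsto> relay a b]"
  \<comment> \<open>Giving every address an account makes all existence conditions trivial.\<close>
  define \<Sigma> :: "'v state" where "\<Sigma> = (\<lambda>_. Some \<lparr>st = Map.empty, balance = 0\<rparr>)"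
  define \<mu> :: "'v monitor_state" where "\<mu> = (\<lambda>_. Map.empty)"
  define Gm where "Gm = G(a \<mapsto> contract_of once)"
  \<comment> \<open>All test transactions share one context, so that two of them can be
    merged.\<close>
  define T where "T = (\<lambda>x f. (undefined :: 'c, call u x f :: 'v operation))"
  have neq: "a \<noteq> b" "u \<noteq> a" "u \<noteq> b"
    by (simp_all add: b_def u_def)
  assume "writable_in_BFS a (once :: ('c, 'v) monitored)"
  moreover have "environment a G"
    using neq by (auto simp: environment_def G_def honest_relay split: if_splits)
  ultimately obtain C where C: "replaces G a once C"
    unfolding writable_in_BFS_def by blast
  define Gp where "Gp = G(a \<mapsto> C)"
  have Gm: "Gm a = Some (contract_of once)" "Gm b = Some (relay a b)"
    and Gp: "Gp b = Some (relay a b)"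
    using neq by (simp_all add: Gm_def Gp_def G_def)
  have total: "x \<in> dom \<Sigma>" for x
    by (simp add: \<Sigma>_def)
  have fields: "storage_fields once = {}"
    by (simp add: once_def)
  have monitor: "monitor_of once = once_monitor"
      "(\<lambda>_. Map.empty)(a := m_storage0 once_monitor) = \<mu>"
    by (auto simp: once_def once_monitor_def \<mu>_def)
  have "dom G \<subseteq> dom \<Sigma> \<and> \<Sigma> a = Some \<lparr>st = Map.empty, balance = 0\<rparr> \<and>
      dom (st \<lparr>st = Map.empty, balance = 0\<rparr>) \<subseteq> storage_fields once"
    by (auto simp: \<Sigma>_def)
  from C[unfolded replaces_def monitor, rule_format, OF this, unfolded fields, folded Gm_def Gp_def]
  obtain s where equiv: "\<And>ts. \<forall>(\<Delta>, op) \<in> set ts. src op \<notin> insert a (dom G) \<Longrightarrow>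
      list_all2 (rel_option (\<lambda>(\<Sigma>m, \<mu>) \<Sigma>p. same_up_to_aux a {} \<Sigma>m \<Sigma>p))
        (outcomes (monitored_transaction Gm [a \<mapsto> once_monitor]) ts (\<Sigma>, \<mu>))
        (outcomes (transaction Gp) ts (\<Sigma>(a \<mapsto> \<lparr>st = Map.empty, balance = 0\<rparr>\<lparr>st := s\<rparr>)))"
    by blast
  \<comment> \<open>The auxiliary fields in \<open>s\<close> are fixed before \<open>ts\<close>, so
    the two tests below, the pair of direct calls and the single relayed call, start from the same
    state.\<close>
  define \<Sigma>0 where "\<Sigma>0 = \<Sigma>(a \<mapsto> \<lparr>st = Map.empty, balance = 0\<rparr>\<lparr>st := s\<rparr>)"
  have external: "\<forall>(\<Delta>, op) \<in> set ts. src op \<notin> insert a (dom G)" if "set ts \<subseteq> {T x f | x f. True}" for ts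
    using that neq by (auto simp: T_def G_def)
  obtain \<mu>1 where m1: "monitored_transaction Gm [a \<mapsto> once_monitor] (T a []) (\<Sigma>, \<mu>) = Some (\<Sigma>, \<mu>1)"
    using monitored_transaction_once[of Gm, OF Gm(1) total total] unfolding T_def by blast
  obtain \<mu>2 where m2: "monitored_transaction Gm [a \<mapsto> once_monitor] (T a []) (\<Sigma>, \<mu>1) = Some (\<Sigma>, \<mu>2)"
    using monitored_transaction_once[of Gm, OF Gm(1) total total] unfolding T_def by blast
  have "set [T a [], T a []] \<subseteq> {T x f | x f. True}"
    by auto
  from equiv[OF external, OF this] obtain \<Sigma>1 \<Sigma>2
    where "transaction Gp (T a []) \<Sigma>0 = Some \<Sigma>1" "transaction Gp (T a []) \<Sigma>1 = Some \<Sigma>2"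
    by (auto simp: m1 m2 option_rel_Some1 \<Sigma>0_def)
  then have "commits Gp undefined \<Sigma>0 [call u a []] \<Sigma>1" "commits Gp undefined \<Sigma>1 [call u a []] \<Sigma>2"
    by (simp_all add: T_def transaction_eq_Some_iff)
  moreover have "b \<in> dom \<Sigma>0" "u \<in> dom \<Sigma>0"
    using total by (auto simp: \<Sigma>0_def)
  \<comment> \<open>Only now is the waiting program known; it is extracted from the run of the
    replacement \<open>C\<close>.\<close>
  ultimately obtain f where "commits Gp undefined \<Sigma>0 [call u b (CHR ''p'' # f)] \<Sigma>2"
    using commits_relay_two_calls Gp neq(2) by meson
  then have "transaction Gp (T b (CHR ''p'' # f)) \<Sigma>0 = Some \<Sigma>2"
    by (simp add: T_def transaction_eq_Some_iff)
  moreover have "monitored_transaction Gm [a \<mapsto> once_monitor] (T b (CHR ''p'' # f)) (\<Sigma>, \<mu>) = None"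
    unfolding T_def by (intro once_relay_two_calls_fail[of Gm] Gm neq)
  moreover have "set [T b (CHR ''p'' # f)] \<subseteq> {T x f | x f. True}"
    by auto
  from equiv[OF external, OF this]
  have "rel_option (\<lambda>(\<Sigma>m, \<mu>) \<Sigma>p. same_up_to_aux a {} \<Sigma>m \<Sigma>p)
      (monitored_transaction Gm [a \<mapsto> once_monitor] (T b (CHR ''p'' # f)) (\<Sigma>, \<mu>))
      (transaction Gp (T b (CHR ''p'' # f)) \<Sigma>0)"
    by (simp add: \<Sigma>0_def)
  ultimately show False
    by simp
qed

theorem theorem3:
  fixes a :: address
  shows "\<exists>M :: ('c, 'v) monitored. monitored_contract a M \<and> \<not> writable_in_BFS a M"
  using monitored_contract_once once_not_writable by blast

end
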